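(* Let $T$ be a tree. (1) If $T+v$ is a graph obtained from $T$ by adding a new vertex $v$ joined to at least one vertex of $T$, and $T+v$ is also a tree, then $$\frac{mp(T)}{2}\leq mp(T+v)\leq 2\,mp(T).$$ (2) If $v\in V(T)$ is such that $T-v$ is a tree, then $$\frac{mp(T)}{2}\leq mp(T-v)\leq 2\,mp(T).$$ Moreover, in both cases the bounds are sharp: for each of the four inequalities there exist a tree $T$ and a vertex $v$ of the corresponding kind for which equality holds.
   Context: All graphs are finite, simple, undirected, with non-empty vertex set (in particular a tree has at least one vertex). A path $v_1v_2\ldots v_k$ (distinct vertices, consecutive ones adjacent, $k\ge 1$) in a graph $G$ is degree monotone if $\deg(v_1)\le \deg(v_2)\le\dots\le\deg(v_k)$ or $\deg(v_1)\ge\deg(v_2)\ge\dots\ge\deg(v_k)$, where degrees are taken in $G$. The length of a degree monotone path is its number of vertices, and $mp(G)$ is the maximum length of a degree monotone path in $G$. $T-v$ is the graph obtained from $T$ by deleting the vertex $v$ and all edges incident with it. *)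

theory Defs
  imports Complex_Main "Graph_Theory.Graph_Theory"
begin

text \<open>
  Finite simple undirected graphs are the symmetric digraphs of locale \<^locale>\<open>graph\<close>: an
  undirected edge is a pair of opposite arcs, so the degree of a vertex is its out-degree.
\<close>

text \<open>
  The library constant \<^const>\<open>tree\<close> cannot be used for undirected graphs: a closed walk
  \<open>u, v, u\<close> along an edge and back counts as a \<^const>\<open>pre_digraph.cycle\<close>. A cycle of an
  undirected simple graph is a \<^const>\<open>pre_digraph.cycle\<close> of length at least 3.
  \<^const>\<open>connected\<close> already includes that the vertex set is non-empty.
\<close>
definition undirected_tree :: "('a, 'b) pre_digraph \<Rightarrow> bool" where
  "undirected_tree G \<longleftrightarrow>
     graph G \<and> connected G \<and> \<not> (\<exists>p. pre_digraph.cycle G p \<and> 3 \<le> length p)"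

definition degree_monotone_path :: "('a, 'b) pre_digraph \<Rightarrow> 'a list \<Rightarrow> bool" where
  "degree_monotone_path G p \<longleftrightarrow>
     vpath p G \<and>
     (sorted_wrt (\<le>) (map (out_degree G) p) \<or> sorted_wrt (\<ge>) (map (out_degree G) p))"

text \<open>The length of a degree monotone path is its number of vertices.\<close>
definition mp :: "('a, 'b) pre_digraph \<Rightarrow> nat" where
  "mp G = Max {length p | p. degree_monotone_path G p}"

text \<open>The maximum is over a finite non-empty set whenever \<open>G\<close> is a non-empty graph.\<close>
lemma mp_set:
  assumes "graph G" "verts G \<noteq> {}"
  shows "finite {length p | p. degree_monotone_path G p}"
    and "{length p | p. degree_monotone_path G p} \<noteq> {}"
proof -
  interpret graph G by fact
  have "length p \<le> card (verts G)" if "degree_monotone_path G p" for p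
    using that card_mono[OF finite_verts, of "set p"]
    by (simp add: degree_monotone_path_def vpath_def vwalk_def distinct_card)
  then show "finite {length p | p. degree_monotone_path G p}"
    by (auto intro!: finite_subset[of _ "{..card (verts G)}"])
  from assms(2) obtain u where "u \<in> verts G" by blast
  then have "degree_monotone_path G [u]"
    by (simp add: degree_monotone_path_def vpath_def vwalk_def)
  then show "{length p | p. degree_monotone_path G p} \<noteq> {}" by blast
qed

text \<open>
  Adding \<open>v\<close> joined to exactly the vertices in \<open>N\<close>; meant for \<open>v \<notin> pverts G\<close> and
  \<open>N \<subseteq> pverts G\<close>. Deleting a vertex is the library's \<^const>\<open>pre_digraph.del_vert\<close>.
\<close>
definition add_joined_vertex :: "'a pair_pre_digraph \<Rightarrow> 'a \<Rightarrow> 'a set \<Rightarrow> 'a pair_pre_digraph" where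
  "add_joined_vertex G v N =
     \<lparr>pverts = insert v (pverts G), parcs = parcs G \<union> {v} \<times> N \<union> N \<times> {v}\<rparr>"

definition tree_extension ::
  "'a pair_pre_digraph \<Rightarrow> 'a \<Rightarrow> 'a pair_pre_digraph \<Rightarrow> bool" where
  "tree_extension T v T' \<longleftrightarrow>
     undirected_tree (with_proj T) \<and> v \<notin> pverts T \<and>
     (\<exists>N. N \<noteq> {} \<and> N \<subseteq> pverts T \<and> T' = add_joined_vertex T v N) \<and>
     undirected_tree (with_proj T')"

definition tree_deletion :: "'a pair_pre_digraph \<Rightarrow> 'a \<Rightarrow> bool" where
  "tree_deletion T v \<longleftrightarrow>
     undirected_tree (with_proj T) \<and> v \<in> pverts T \<and>
     undirected_tree (pre_digraph.del_vert (with_proj T) v)"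

end

theory Submission
  imports Defs
begin

text \<open>
  As \<open>T'\<close> has no cycle, the new vertex \<open>v\<close> has a single neighbour \<open>u\<close>, and passing from \<open>T\<close> to
  \<open>T'\<close> only raises the degree of \<open>u\<close> by one. Cut an ascending path of either tree at \<open>u\<close>. An
  ascending path of \<open>T\<close> splits into \<open>A u\<close> and \<open>B\<close>, both still ascending in \<open>T'\<close>; an ascending
  path of \<open>T'\<close> avoiding \<open>v\<close> splits into \<open>A\<close> and \<open>u B\<close>, both still ascending in \<open>T\<close>. A path of
  \<open>T'\<close> through \<open>v\<close> has the leaf \<open>v\<close> at an end. Deleting a vertex is the reverse operation.
\<close>

section \<open>Degree monotone paths and bounds on \<open>mp\<close>\<close>

lemma length_le_mp:
  assumes "graph G" "degree_monotone_path G p"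
  shows "length p \<le> mp G"
proof -
  have "verts G \<noteq> {}"
    using assms(2) by (auto simp: degree_monotone_path_def vpath_def vwalk_def)
  then show ?thesis
    unfolding mp_def using assms mp_set(1) by (intro Max_ge) auto
qed

lemma mp_le:
  assumes "graph G" "verts G \<noteq> {}" "\<And>p. degree_monotone_path G p \<Longrightarrow> length p \<le> k"
  shows "mp G \<le> k"
  unfolding mp_def using assms mp_set[OF assms(1,2)] by (subst Max_le_iff) auto

lemma vpath_rev:
  assumes "graph G" "vpath p G"
  shows "vpath (rev p) G"
proof -
  interpret graph G by fact
  show ?thesis using assms(2) vwalk_rev_ex[OF sym_arcs] by (auto simp: vpath_def)
qed

lemma vpath_append:
  assumes "vpath (p @ q) G"
  shows "p \<noteq> [] \<Longrightarrow> vpath p G" "q \<noteq> [] \<Longrightarrow> vpath q G"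
  using assms vwalkI_append_l[of p q G] vwalkI_append_r[of q p G] by (auto simp: vpath_def)

lemma degree_monotone_path_rev:
  assumes "graph G" "degree_monotone_path G p"
  shows "degree_monotone_path G (rev p)"
  using assms vpath_rev[OF assms(1)]
  by (auto simp: degree_monotone_path_def rev_map[symmetric] sorted_wrt_rev)

text \<open>A descending path read backwards is an ascending path of the same length, because the
  arcs are symmetric. So upper bounds on \<open>mp\<close> may look at ascending paths
  alone.\<close>

lemma mp_le_ascending:
  assumes "graph G" "verts G \<noteq> {}"
    and "\<And>p. vpath p G \<Longrightarrow> sorted (map (out_degree G) p) \<Longrightarrow> length p \<le> k"
  shows "mp G \<le> k"
proof (rule mp_le[OF assms(1,2)])
  fix p assume p: "degree_monotone_path G p"
  show "length p \<le> k"
  proof (cases "sorted (map (out_degree G) p)")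
    case True
    then show ?thesis using assms(3) p by (auto simp: degree_monotone_path_def)
  next
    case False
    then have "sorted (map (out_degree G) (rev p))" "vpath (rev p) G"
      using p vpath_rev[OF assms(1)]
      by (auto simp: degree_monotone_path_def rev_map[symmetric] sorted_wrt_rev)
    then show ?thesis using assms(3)[of "rev p"] by simp
  qed
qed

lemma length_le_mp_ascending:
  assumes "graph G" "vpath p G" "sorted (map (out_degree G) p)"
  shows "length p \<le> mp G"
  using assms by (intro length_le_mp) (auto simp: degree_monotone_path_def)

text \<open>Source of the factor 2: a path is cut into two pieces. The empty list is not a path,
  hence the conditional premises; an empty piece contributes 0.\<close>

lemma length_append_le_mp:
  assumes "graph G" "p \<noteq> [] \<Longrightarrow> degree_monotone_path G p" "q \<noteq> [] \<Longrightarrow> degree_monotone_path G q"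
  shows "length (p @ q) \<le> 2 * mp G"
  using length_le_mp[OF assms(1), of p] length_le_mp[OF assms(1), of q] assms(2,3)
  by (cases "p = []"; cases "q = []") auto

section \<open>Adding a vertex to a graph\<close>

lemma add_joined_vertex_simps [simp]:
  "pverts (add_joined_vertex T v N) = insert v (pverts T)"
  "parcs (add_joined_vertex T v N) = parcs T \<union> {v} \<times> N \<union> N \<times> {v}"
  by (simp_all add: add_joined_vertex_def)

lemma graph_add_joined_vertex:
  assumes "graph (with_proj T)" "v \<notin> pverts T" "N \<subseteq> pverts T"
  shows "graph (with_proj (add_joined_vertex T v N))"
proof -
  interpret T: pair_graph T by (rule pair_graphI_graph) fact
  have "finite N" using assms(3) T.pair_finite_verts finite_subset by blast
  then have "pair_graph (add_joined_vertex T v N)"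
    using assms T.pair_finite_verts T.pair_finite_arcs
    by unfold_locales
      (auto simp: symmetric_def sym_def dest: T.wellformed' T.no_loops' T.arcs_symmetric)
  then show ?thesis by (rule pair_graph.pair_graphD_graph)
qed

text \<open>All new arcs meet \<open>v\<close>, so a walk that avoids \<open>v\<close> can only use
  arcs of \<open>T\<close>.\<close>

lemma vpath_add_joined_vertex:
  assumes "v \<notin> pverts T"
  shows "vpath p (with_proj T) \<longleftrightarrow> vpath p (with_proj (add_joined_vertex T v N)) \<and> v \<notin> set p"
proof -
  have "set (vwalk_arcs p) \<subseteq> parcs T \<union> {v} \<times> N \<union> N \<times> {v} \<longleftrightarrow> set (vwalk_arcs p) \<subseteq> parcs T"
    if "v \<notin> set p"
  proof -
    have "fst e \<noteq> v \<and> snd e \<noteq> v" if "e \<in> set (vwalk_arcs p)" for e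
      using that \<open>v \<notin> set p\<close> by (metis in_set_vwalk_arcsE prod.collapse)
    then show ?thesis by fastforce
  qed
  then show ?thesis
    using assms by (auto simp: vpath_def vwalk_def)
qed

section \<open>Both bounds on \<open>mp\<close> when a leaf is attached\<close>

text \<open>The comparison of \<open>mp\<close> depends only on how degrees and paths change at
  \<open>u\<close> and \<open>v\<close>, so it is carried out for arbitrary graphs \<open>T\<close>;
  trees return with \<open>undirected_tree_T'\<close>.\<close>

locale leaf_extension =
  fixes T :: "'a pair_pre_digraph" and v u :: 'a
  assumes graph_T: "graph (with_proj T)" and v_notin: "v \<notin> pverts T" and u_in: "u \<in> pverts T"
begin

sublocale T: pair_graph T by (rule pair_graphI_graph) (rule graph_T)

abbreviation T' where "T' \<equiv> add_joined_vertex T v {u}"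

lemma graph_T': "graph (with_proj T')"
  using graph_T v_notin u_in by (intro graph_add_joined_vertex) auto

sublocale T': pair_graph T' by (rule pair_graphI_graph) (rule graph_T')

lemma out_degree_T':
  "out_degree (with_proj T') w =
     (if w = v then 1 else if w = u then Suc (out_degree (with_proj T) w)
      else out_degree (with_proj T) w)"
proof -
  have "out_arcs (with_proj T') w =
    (if w = v then {(v, u)} else if w = u then insert (u, v) (out_arcs (with_proj T) w)
      else out_arcs (with_proj T) w)"
    using v_notin u_in by (auto dest: T.wellformed')
  moreover have "(u, v) \<notin> out_arcs (with_proj T) w"
    using v_notin by (auto dest: T.wellformed')
  ultimately show ?thesis
    using T.finite_out_arcs[of w] by (auto simp: out_degree_def simp del: in_out_arcs_conv)
qed

lemma out_degree_T'_other:
  "u \<notin> set p \<Longrightarrow> v \<notin> set p \<Longrightarrow>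
    map (out_degree (with_proj T')) p = map (out_degree (with_proj T)) p"
  by (auto simp: out_degree_T')

lemmas vpath_T_iff = vpath_add_joined_vertex[OF v_notin, of _ "{u}"]

lemma mp_T_le: "mp (with_proj T) \<le> 2 * mp (with_proj T')"
proof (rule mp_le_ascending[OF graph_T])
  show "verts (with_proj T) \<noteq> {}" using u_in by auto
next
  fix p assume p: "vpath p (with_proj T)" "sorted (map (out_degree (with_proj T)) p)"
  have p': "vpath p (with_proj T')" and "v \<notin> set p" using p vpath_T_iff by auto
  show "length p \<le> 2 * mp (with_proj T')"
  proof (cases "u \<in> set p")
    case False
    then show ?thesis
      using length_le_mp_ascending[OF graph_T' p'] out_degree_T'_other p(2) \<open>v \<notin> set p\<close>
      by (simp del: map_eq_conv)
  next
    case True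
    \<comment> \<open>The cut comes right after \<open>u\<close>: its degree is larger in
      \<open>T'\<close>, which is harmless at the end of an ascending path but could break the
      ascent into \<open>B\<close>.\<close>
    then obtain A B where AB: "p = (A @ [u]) @ B"
      by (metis append_Cons append_Nil append_assoc in_set_conv_decomp)
    have dist: "distinct p" using p by (auto simp: vpath_def)
    have "length ((A @ [u]) @ B) \<le> 2 * mp (with_proj T')"
    proof (rule length_append_le_mp[OF graph_T'])
      have "u \<notin> set A" "v \<notin> set A" "u \<notin> set B" "v \<notin> set B" "u \<noteq> v"
        using AB dist \<open>v \<notin> set p\<close> by auto
      note eq = out_degree_T'_other[OF this(1,2)] out_degree_T'_other[OF this(3,4)] this(5)
      show "degree_monotone_path (with_proj T') (A @ [u])"
        using vpath_append(1)[OF p'[unfolded AB]] p(2) eq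
        by (auto simp: degree_monotone_path_def AB sorted_append out_degree_T' simp del: map_eq_conv)
      show "degree_monotone_path (with_proj T') B" if "B \<noteq> []"
        using vpath_append(2)[OF p'[unfolded AB] that] p(2) eq
        by (auto simp: degree_monotone_path_def AB sorted_append simp del: map_eq_conv)
    qed
    then show ?thesis using AB by simp
  qed
qed

text \<open>Going back to \<open>T\<close> lowers only the degree of \<open>u\<close>, and lowering
  the first entry keeps a list ascending.\<close>

lemma sorted_out_degree_T:
  assumes "sorted (map (out_degree (with_proj T')) (u # q))" "u \<notin> set q" "v \<notin> set (u # q)"
  shows "sorted (map (out_degree (with_proj T)) (u # q))"
proof -
  have "map (out_degree (with_proj T')) q = map (out_degree (with_proj T)) q"
    using assms(2,3) by (intro out_degree_T'_other) auto
  then show ?thesis using assms(1,3) by (auto simp: out_degree_T' simp del: map_eq_conv)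
qed

lemma length_ascending_le:
  assumes p: "vpath p (with_proj T')" "sorted (map (out_degree (with_proj T')) p)" and "v \<notin> set p"
  shows "length p \<le> 2 * mp (with_proj T)"
proof -
  have p': "vpath p (with_proj T)" using assms vpath_T_iff by auto
  show ?thesis
  proof (cases "u \<in> set p")
    case False
    then show ?thesis
      using length_le_mp_ascending[OF graph_T p'] out_degree_T'_other p(2) \<open>v \<notin> set p\<close>
      by (simp del: map_eq_conv)
  next
    case True
    \<comment> \<open>Now the cut comes right before \<open>u\<close>, whose degree drops on the way
      to \<open>T\<close>: harmless at the start of a piece.\<close>
    then obtain A B where AB: "p = A @ u # B" by (metis in_set_conv_decomp)
    have notin: "u \<notin> set A" "u \<notin> set B" "v \<notin> set (u # B)"
      using AB p(1) \<open>v \<notin> set p\<close> by (auto simp: vpath_def)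
    have "length (A @ u # B) \<le> 2 * mp (with_proj T)"
    proof (rule length_append_le_mp[OF graph_T])
      show "degree_monotone_path (with_proj T) (u # B)"
        using vpath_append(2)[OF p'[unfolded AB]] p(2) sorted_out_degree_T[OF _ notin(2,3)]
        by (auto simp: degree_monotone_path_def AB sorted_append simp del: map_eq_conv)
      show "degree_monotone_path (with_proj T) A" if "A \<noteq> []"
        using vpath_append(1)[OF p'[unfolded AB] that] p(2) out_degree_T'_other[OF notin(1)] \<open>v \<notin> set p\<close>
        by (auto simp: degree_monotone_path_def AB sorted_append simp del: map_eq_conv)
    qed
    then show ?thesis using AB by simp
  qed
qed

text \<open>Lets the factor 2 absorb the extra vertex \<open>v\<close>, by
  \<open>1 + k \<le> 2 * k\<close> for \<open>1 \<le> k\<close>.\<close>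

lemma mp_T_pos: "1 \<le> mp (with_proj T)"
  using length_le_mp_ascending[OF graph_T, of "[u]"] u_in by (simp add: vpath_def)

text \<open>If the path ascends, dropping \<open>v\<close> leaves an ascending path of
  \<open>T\<close>, so the length is at most \<open>1 + mp\<close>. If it does not, then
  \<open>u\<close> has degree at most 1 in \<open>T'\<close>, so \<open>u\<close> is isolated in
  \<open>T\<close> and the path is just \<open>v u\<close>.\<close>

lemma length_from_leaf_le:
  assumes "degree_monotone_path (with_proj T') (v # q)"
  shows "length (v # q) \<le> 2 * mp (with_proj T)"
proof (cases q)
  case Nil
  then show ?thesis using mp_T_pos by simp
next
  case (Cons w q')
  have path: "vpath (v # w # q') (with_proj T')"
    using assms Cons by (simp add: degree_monotone_path_def)
  then have "(v, w) \<in> parcs T'" "vpath (w # q') (with_proj T')" "v \<notin> set (w # q')"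
    using T'.vwalk_Cons_Cons[of v w q'] by (auto simp: vpath_def)
  then have [simp]: "w = u" and uq: "vpath (u # q') (with_proj T)" "v \<notin> set (u # q')"
    using v_notin u_in vpath_T_iff by (auto dest: T.wellformed')
  have u_notin: "u \<notin> set q'" using uq by (simp add: vpath_def)
  show ?thesis
  proof (cases "sorted (map (out_degree (with_proj T')) (v # q))")
    case True
    then have "length (u # q') \<le> mp (with_proj T)"
      using length_le_mp_ascending[OF graph_T uq(1)] sorted_out_degree_T[OF _ u_notin uq(2)] Cons by simp
    then show ?thesis using Cons mp_T_pos by simp
  next
    case False
    then have "sorted_wrt (\<ge>) (map (out_degree (with_proj T')) (v # q))"
      using assms unfolding degree_monotone_path_def by blast
    then have "out_degree (with_proj T') u \<le> out_degree (with_proj T') v"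
      by (simp add: Cons)
    then have "out_degree (with_proj T) u = 0" using uq(2) by (auto simp: out_degree_T')
    then have "out_arcs (with_proj T) u = {}"
      using T.finite_out_arcs by (simp add: out_degree_def)
    moreover have "(u, hd q') \<in> out_arcs (with_proj T) u" if "q' \<noteq> []"
      using uq(1) that by (cases q') (auto simp: vpath_def)
    ultimately have "q' = []" by blast
    then show ?thesis using Cons mp_T_pos by simp
  qed
qed

text \<open>A path with \<open>v\<close> at its end is reversed to start there, which exchanges
  ascending and descending. Hence \<open>mp_le\<close> is used here, and
  \<open>length_from_leaf_le\<close> covers both directions.\<close>

lemma mp_T'_le: "mp (with_proj T') \<le> 2 * mp (with_proj T)"
proof (rule mp_le[OF graph_T'])
  show "verts (with_proj T') \<noteq> {}" by simp
next
  fix p assume p: "degree_monotone_path (with_proj T') p"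
  show "length p \<le> 2 * mp (with_proj T)"
  proof (cases "v \<in> set p")
    case False
    then show ?thesis
      using length_ascending_le[of p] length_ascending_le[of "rev p"] p vpath_rev[OF graph_T', of p]
      by (auto simp: degree_monotone_path_def rev_map[symmetric] sorted_wrt_rev)
  next
    case True
    then obtain A B where AB: "p = A @ v # B" by (metis in_set_conv_decomp)
    have path: "vpath (A @ v # B) (with_proj T')" using p AB by (simp add: degree_monotone_path_def)
    \<comment> \<open>An inner vertex \<open>v\<close> would have \<open>u\<close> on both sides,
      against distinctness.\<close>
    have nbr: "w = u" if "(v, w) \<in> parcs T' \<or> (w, v) \<in> parcs T'" for w
      using that v_notin u_in by (auto dest: T.wellformed')
    have "(last A, v) \<in> parcs T'" if "A \<noteq> []"
      using path that by (simp add: vpath_def vwalk_def vwalk_arcs_append)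
    then have "last A = u" if "A \<noteq> []" using that nbr by blast
    moreover have "(v, hd B) \<in> parcs T'" if "B \<noteq> []"
      using vpath_append(2)[OF path] that by (simp add: vpath_def vwalk_def vwalk_arcs_append)
    then have "hd B = u" if "B \<noteq> []" using that nbr by blast
    moreover have "set A \<inter> set B = {}" using path by (auto simp: vpath_def)
    ultimately have "A = [] \<or> B = []" by (metis disjoint_iff hd_in_set last_in_set)
    then show ?thesis
      using length_from_leaf_le[of B] length_from_leaf_le[of "rev A"] AB p
        degree_monotone_path_rev[OF graph_T' p] by auto
  qed
qed

end

section \<open>Attaching a leaf to a tree gives a tree\<close>

text \<open>Without its first entry, the vertex list of a closed walk is the list of the heads of
  its arcs. Rotating the arcs permutes the heads, so distinctness survives; the new base point is
  the vertex where \<open>p\<close> ends.\<close>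

lemma cycle_append_commute:
  assumes "wf_digraph G" "pre_digraph.cycle G (p @ q)"
  shows "pre_digraph.cycle G (q @ p)"
proof -
  interpret wf_digraph G by fact
  have tl: "tl (awalk_verts x r) = map (head G) r" if "awalk x r y" for x r y
    using that awalk_verts_conv'[of x r y] by auto
  obtain x where x: "awalk x (p @ q) x" "distinct (tl (awalk_verts x (p @ q)))" "p @ q \<noteq> []"
    using assms(2) by (auto simp: cycle_def)
  then have "awalk (awlast x p) (q @ p) (awlast x p)"
    using awalk_appendI[of "awlast x p" q x p "awlast x p"] by auto
  moreover have "distinct (map (head G) (q @ p))" using x(2) unfolding tl[OF x(1)] by auto
  ultimately show ?thesis using x(3) unfolding cycle_def by (metis tl append_is_Nil_conv)
qed

context leaf_extension begin

text \<open>
  Rotated so as to start at the leaf \<open>v\<close>, a long cycle through \<open>v\<close> would read \<open>v u s u v\<close>.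
\<close>
lemma cycle_T'_imp_cycle_T:
  assumes "T'.cycle p" "3 \<le> length p"
  shows "T.cycle p"
proof -
  \<comment> \<open>The vertices of a walk, read once from the tails and once from the heads of its
    arcs.\<close>
  have "map fst q @ [z] = y # map snd q \<and> pawalk_verts y q = y # map snd q"
    if "pcas y q z" for y z and q :: "('a \<times> 'a) list"
    using that by (induction q arbitrary: y) auto
  then have verts: "map fst q @ [z] = y # map snd q" "pawalk_verts y q = y # map snd q"
    if "T'.awalk y q z" for y q z
    using that unfolding T'.awalk_def by blast+
  obtain x where x: "T'.awalk x p x" "distinct (tl (pawalk_verts x p))" "p \<noteq> []"
    using assms(1) by (auto simp: T'.cycle_def)
  show ?thesis
  proof (cases "v \<in> fst ` set p")
    case False
    \<comment> \<open>In a closed walk the tails and the heads agree as multisets. So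
      \<open>v\<close> is not a head either, and no new arc occurs.\<close>
    have "mset (map fst p) = mset (map snd p)"
      using arg_cong[OF verts(1)[OF x(1)], of mset] by simp
    then have "fst ` set p = snd ` set p" by (metis set_map set_mset_mset)
    then have "e \<in> parcs T" if "e \<in> set p" for e
      using that False x(1) by (force simp: T'.awalk_def)
    moreover have "x \<in> pverts T"
      using False x by (cases p) (auto simp: T'.awalk_def)
    ultimately have "T.awalk x p x" using x(1) by (auto simp: T.awalk_def T'.awalk_def)
    then show ?thesis using x by (auto simp: T.cycle_def)
  next
    case True
    then obtain q e r where p: "p = q @ e # r" and "fst e = v"
      by (metis image_iff in_set_conv_decomp)
    then have "T'.cycle (e # r @ q)"
      using cycle_append_commute[OF T'.wf_digraph, of q "e # r"] assms(1) by simp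
    then obtain y where y: "T'.awalk y (e # r @ q) y" "distinct (tl (pawalk_verts y (e # r @ q)))"
      by (auto simp: T'.cycle_def)
    have nbr: "w = u" if "(v, w) \<in> parcs T' \<or> (w, v) \<in> parcs T'" for w
      using that v_notin u_in by (auto dest: T.wellformed')
    have "e \<in> parcs T'" "y = v" using y(1) \<open>fst e = v\<close> by (simp_all add: T'.awalk_Cons_iff)
    then have [simp]: "e = (v, u)" using \<open>fst e = v\<close> nbr by (metis prod.collapse)
    \<comment> \<open>Length at least 3 leaves a non-empty \<open>s\<close> between the arcs
      \<open>(v, u)\<close> and \<open>(u, v)\<close>; the back-and-forth walk of length 2 is
      excluded here.\<close>
    have "r @ q \<noteq> []" using assms(2) p by (cases "r @ q") auto
    then obtain s f where s: "r @ q = s @ [f]" by (metis rev_exhaust)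
    have "s \<noteq> []" using assms(2) p arg_cong[OF s, of length] by auto
    have walk: "T'.awalk u (s @ [f]) v"
      using y(1) s \<open>y = v\<close> by (simp add: T'.awalk_Cons_iff del: T'.awalk_append_iff)
    then have "f \<in> parcs T'" "snd f = v" by (simp_all add: T'.awalk_Cons_iff T'.awalk_Nil_iff)
    then have "f = (u, v)" using nbr by (metis prod.collapse)
    then have "T'.awalk u s u" using walk by (auto simp: T'.awalk_Cons_iff)
    \<comment> \<open>The closed walk \<open>s\<close> ends with an arc into \<open>u\<close>, but
      \<open>u\<close> is already the head of \<open>e\<close>: the heads repeat, a
      contradiction.\<close>
    then have "last (u # map snd s) = u" using verts(1)[of u s u] by (metis last_snoc)
    then have "u \<in> set (map snd s)"
      using \<open>s \<noteq> []\<close> by (metis last_ConsR last_in_set map_is_Nil_conv)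
    moreover have "distinct (u # map snd s @ [v])"
      using y(2) s \<open>f = (u, v)\<close> unfolding verts(2)[OF y(1)] by simp
    ultimately show ?thesis by simp
  qed
qed

text \<open>Any two vertices are connected through \<open>u\<close>, and a cycle of length at least
  3 would already be one of \<open>T\<close>.\<close>

lemma undirected_tree_T':
  assumes "undirected_tree (with_proj T)"
  shows "undirected_tree (with_proj T')"
proof -
  have "strongly_connected (with_proj T)"
    using T.symmetric_connected_imp_strongly_connected assms T.sym_arcs
    by (simp add: undirected_tree_def)
  moreover have "subgraph (with_proj T) (with_proj T')"
    by (rule subgraphI) (auto intro: T.wf_digraph T'.wf_digraph)
  ultimately have T_reach: "x \<rightarrow>\<^sup>*\<^bsub>with_proj T'\<^esub> y" if "x \<in> pverts T" "y \<in> pverts T" for x y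
    using that T'.reachable_mono by (metis strongly_connectedE with_proj_simps(1))
  have arcs: "u \<rightarrow>\<^sup>*\<^bsub>with_proj T'\<^esub> v" "v \<rightarrow>\<^sup>*\<^bsub>with_proj T'\<^esub> u"
    by (auto intro!: T'.reachable_adjI)
  have "x \<rightarrow>\<^sup>*\<^bsub>with_proj T'\<^esub> y" if "x \<in> pverts T'" "y \<in> pverts T'" for x y
  proof -
    have "x \<rightarrow>\<^sup>*\<^bsub>with_proj T'\<^esub> u" "u \<rightarrow>\<^sup>*\<^bsub>with_proj T'\<^esub> y"
      using that T_reach u_in arcs by auto
    then show ?thesis by (rule T'.reachable_trans)
  qed
  then have "connected (with_proj T')"
    using T'.reachable_mk_symmetricI by (intro T'.connectedI) auto
  then show ?thesis
    using assms cycle_T'_imp_cycle_T graph_T' by (auto simp: undirected_tree_def)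
qed

lemma tree_extension_T':
  assumes "undirected_tree (with_proj T)"
  shows "tree_extension T v T'"
  using assms undirected_tree_T' u_in v_notin by (auto simp: tree_extension_def)

end

section \<open>Tree extensions attach leaves, and tree deletions reverse them\<close>

text \<open>\<open>connected\<close> speaks of the symmetric closure; since the arcs are symmetric,
  this gives reachability in \<open>G\<close> itself.\<close>

lemma undirected_tree_imp_reachable:
  assumes "undirected_tree G" "x \<in> verts G" "y \<in> verts G"
  shows "x \<rightarrow>\<^sup>*\<^bsub>G\<^esub> y"
proof -
  interpret graph G using assms(1) by (simp add: undirected_tree_def)
  show ?thesis
    using symmetric_connected_imp_strongly_connected[OF sym_arcs] assms
    by (auto simp: undirected_tree_def)
qed

text \<open>Two neighbours of \<open>v\<close> would close a cycle with the path joining them in \<open>T\<close>.\<close>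
lemma tree_extension_leaf:
  assumes "tree_extension T v T'"
  obtains u where "leaf_extension T v u" "T' = add_joined_vertex T v {u}"
proof -
  obtain N where N: "N \<noteq> {}" "N \<subseteq> pverts T" and T': "T' = add_joined_vertex T v N"
    and T: "undirected_tree (with_proj T)" "v \<notin> pverts T" "undirected_tree (with_proj T')"
    using assms by (auto simp: tree_extension_def)
  interpret T: pair_graph T using T(1) by (auto simp: undirected_tree_def intro: pair_graphI_graph)
  interpret T': pair_graph T' using T(3) by (auto simp: undirected_tree_def intro: pair_graphI_graph)
  have "x = y" if "x \<in> N" "y \<in> N" for x y
  proof (rule ccontr)
    assume "x \<noteq> y"
    have "x \<rightarrow>\<^sup>*\<^bsub>with_proj T\<^esub> y" using that N(2) T(1) by (intro undirected_tree_imp_reachable) auto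
    \<comment> \<open>A walk without repeated vertices is chosen, so that closing it through the new
      vertex \<open>v\<close> repeats none. It has at least one arc, which makes the cycle long
      enough.\<close>
    then obtain p where p: "T.apath x p y" using T.reachable_apath by auto
    then have "p \<noteq> []" using \<open>x \<noteq> y\<close> by (auto simp: T.apath_Nil_iff)
    have walk: "T.awalk x p y" using p by (rule T.awalkI_apath)
    have arcs: "(v, x) \<in> parcs T'" "(y, v) \<in> parcs T'" "v \<in> pverts T'" using that by (simp_all add: T')
    have "T'.awalk x p y"
      using walk unfolding T.awalk_def T'.awalk_def by (auto simp: T')
    then have "T'.awalk x (p @ [(y, v)]) v"
      using arcs by (auto simp: T'.awalk_Cons_iff T'.awalk_Nil_iff)
    moreover from this have "pawalk_verts x (p @ [(y, v)]) = pawalk_verts x p @ [v]"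
      using T'.awalk_verts_append by auto
    moreover have "v \<notin> set (pawalk_verts x p)" using walk T(2) by auto
    ultimately have "T'.cycle ((v, x) # p @ [(y, v)])"
      using p arcs unfolding T'.cycle_def T.apath_def
      by (intro exI[of _ v]) (simp add: T'.awalk_Cons_iff del: T'.awalk_append_iff)
    moreover have "3 \<le> length ((v, x) # p @ [(y, v)])" using \<open>p \<noteq> []\<close> by (cases p) auto
    ultimately show False using T(3) unfolding undirected_tree_def by blast
  qed
  then obtain u where "N = {u}" using N(1) by blast
  then show ?thesis
    using that[of u] T N T' by (auto simp: leaf_extension_def undirected_tree_def)
qed

lemma tree_extension_mp:
  assumes "tree_extension T v T'"
  shows "mp (with_proj T) \<le> 2 * mp (with_proj T')" "mp (with_proj T') \<le> 2 * mp (with_proj T)"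
  using tree_extension_leaf[OF assms] leaf_extension.mp_T_le leaf_extension.mp_T'_le by metis+

lemma del_vert_add_joined_vertex:
  assumes "graph (with_proj T)" "v \<notin> pverts T"
  shows "pre_digraph.del_vert (with_proj (add_joined_vertex T v N)) v = with_proj T"
proof -
  interpret pair_graph T using assms(1) by (rule pair_graphI_graph)
  show ?thesis
    using assms(2) by (auto simp: pre_digraph.del_vert_def with_proj_def dest: wellformed')
qed

text \<open>Turns each extremal example for extensions into one for deletions, with the two trees
  exchanged.\<close>

lemma tree_extension_imp_tree_deletion:
  assumes "tree_extension T v T'"
  shows "tree_deletion T' v" "pre_digraph.del_vert (with_proj T') v = with_proj T"
proof -
  obtain N where T': "T' = add_joined_vertex T v N" and T: "graph (with_proj T)" "v \<notin> pverts T"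
    using assms by (auto simp: tree_extension_def undirected_tree_def)
  show del: "pre_digraph.del_vert (with_proj T') v = with_proj T"
    unfolding T' using T by (rule del_vert_add_joined_vertex)
  show "tree_deletion T' v"
    using assms del T' by (simp add: tree_extension_def tree_deletion_def)
qed

lemma tree_deletion_imp_tree_extension:
  assumes "tree_deletion T v"
  obtains T0 where "tree_extension T0 v T" "pre_digraph.del_vert (with_proj T) v = with_proj T0"
proof -
  \<comment> \<open>The deleted graph as a \<open>pair_pre_digraph\<close>, the type that
    \<open>tree_extension\<close> requires.\<close>
  define T0 where
    "T0 = \<lparr>pverts = pverts T - {v}, parcs = {a \<in> parcs T. fst a \<noteq> v \<and> snd a \<noteq> v}\<rparr>"
  define N where "N = {w. (v, w) \<in> parcs T}"
  have T: "undirected_tree (with_proj T)" "v \<in> pverts T"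
    and del: "undirected_tree (pre_digraph.del_vert (with_proj T) v)"
    using assms by (auto simp: tree_deletion_def)
  interpret pair_graph T using T(1) by (auto simp: undirected_tree_def intro: pair_graphI_graph)
  have T0: "pre_digraph.del_vert (with_proj T) v = with_proj T0"
    by (simp add: pre_digraph.del_vert_def with_proj_def T0_def)
  \<comment> \<open>A tree has a vertex, so some \<open>w\<close> other than \<open>v\<close>
    exists; the first arc of a walk from \<open>v\<close> to \<open>w\<close> shows that
    \<open>v\<close> has a neighbour.\<close>
  have "verts (with_proj T0) \<noteq> {}"
    using del T0 by (auto simp: undirected_tree_def connected_conv)
  then obtain w where w: "w \<in> pverts T" "w \<noteq> v" by (auto simp: T0_def)
  have "v \<rightarrow>\<^sup>*\<^bsub>with_proj T\<^esub> w" using T w by (intro undirected_tree_imp_reachable) auto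
  then have "N \<noteq> {}" using w by (cases rule: converse_reachable_cases) (auto simp: N_def)
  moreover have "N \<subseteq> pverts T0" by (auto simp: N_def T0_def dest: wellformed' no_loops')
  moreover have "T = add_joined_vertex T0 v N"
  proof (rule pair_pre_digraph.equality)
    show "parcs T = parcs (add_joined_vertex T0 v N)"
      by (auto simp: T0_def N_def dest: arcs_symmetric)
  qed (use T in \<open>auto simp: T0_def\<close>)
  ultimately have "\<exists>N. N \<noteq> {} \<and> N \<subseteq> pverts T0 \<and> T = add_joined_vertex T0 v N" by blast
  moreover have "v \<notin> pverts T0" by (simp add: T0_def)
  ultimately have "tree_extension T0 v T"
    using T(1) del unfolding T0 tree_extension_def by blast
  then show ?thesis using that T0 by blast
qed

section \<open>Trees attaining the bounds\<close>

lemma undirected_tree_singleton: "undirected_tree (with_proj \<lparr>pverts = {a}, parcs = {}\<rparr>)"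
proof -
  interpret pair_graph "\<lparr>pverts = {a}, parcs = {}\<rparr>"
    by unfold_locales (auto simp: symmetric_def sym_def)
  have "\<not> cycle p" for p by (auto simp: cycle_def awalk_def)
  then show ?thesis
    using pair_graphD_graph by (auto simp: undirected_tree_def connected_conv)
qed

lemma mp_singleton_le: "mp (with_proj \<lparr>pverts = {a}, parcs = {}\<rparr>) \<le> 1"
proof (rule mp_le)
  fix p assume "degree_monotone_path (with_proj \<lparr>pverts = {a}, parcs = {}\<rparr>) p"
  then have "distinct p" "set p \<subseteq> {a}" by (auto simp: degree_monotone_path_def vpath_def vwalk_def)
  then show "length p \<le> 1" using card_mono[of "{a}" "set p"] by (simp add: distinct_card)
qed (use undirected_tree_singleton[of a] in \<open>auto simp: undirected_tree_def\<close>)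

lemma tree_extension_add_leaf:
  assumes "undirected_tree (with_proj T)" "v \<notin> pverts T" "u \<in> pverts T"
  shows "tree_extension T v (add_joined_vertex T v {u})"
proof -
  interpret leaf_extension T v u
    using assms by (auto simp: leaf_extension_def undirected_tree_def)
  show ?thesis using assms(1) by (rule tree_extension_T')
qed

text \<open>A single vertex grows into a single edge, whose two ends both have degree 1:
  \<open>mp\<close> goes from 1 to 2.\<close>

lemma mp_doubles:
  obtains T T' :: "nat pair_pre_digraph" and v
  where "tree_extension T v T'" "mp (with_proj T') = 2 * mp (with_proj T)"
proof -
  define T :: "nat pair_pre_digraph" where "T = \<lparr>pverts = {0}, parcs = {}\<rparr>"
  define T' where "T' = add_joined_vertex T 1 {0}"
  have ext: "tree_extension T 1 T'"
    unfolding T'_def using undirected_tree_singleton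
    by (intro tree_extension_add_leaf) (auto simp: T_def)
  have "out_arcs (with_proj T') 0 = {(0, 1)}" "out_arcs (with_proj T') 1 = {(1, 0)}"
    by (auto simp: T'_def T_def)
  then have "length [0, 1 :: nat] \<le> mp (with_proj T')"
    using ext by (intro length_le_mp_ascending)
      (auto simp: tree_extension_def undirected_tree_def vpath_def vwalk_def T'_def T_def out_degree_def)
  then have "mp (with_proj T') = 2 * mp (with_proj T)"
    using tree_extension_mp[OF ext] mp_singleton_le[of "0::nat"] by (simp add: T_def)
  then show ?thesis using that ext by blast
qed

text \<open>Reduces degrees in a concrete graph to evaluating a list of arcs.\<close>

lemma out_degree_eq_length_filter:
  assumes "parcs G = set es" "distinct es"
  shows "out_degree (with_proj G) x = length (filter (\<lambda>e. fst e = x) es)"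
proof -
  have "out_arcs (with_proj G) x = set (filter (\<lambda>e. fst e = x) es)"
    by (simp add: out_arcs_def assms(1))
  then show ?thesis
    using assms(2) distinct_card[of "filter (\<lambda>e. fst e = x) es"] by (simp add: out_degree_def)
qed

text \<open>\<open>T\<close> is the path \<open>0 1 2 3\<close> with two further leaves 4 and 5 at
  3. The new leaf 6 at 1 makes \<open>T'\<close> symmetric: 1 and 3 carry two leaves each and are
  joined through 2. Here \<open>mp\<close> drops from 4 to 2.\<close>

lemma mp_halves:
  obtains T T' :: "nat pair_pre_digraph" and v
  where "tree_extension T v T'" "mp (with_proj T) = 2 * mp (with_proj T')"
proof -
  define T0 :: "nat pair_pre_digraph" where "T0 = \<lparr>pverts = {0}, parcs = {}\<rparr>"
  define T1 where "T1 = add_joined_vertex T0 1 {0}"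
  define T2 where "T2 = add_joined_vertex T1 2 {1}"
  define T3 where "T3 = add_joined_vertex T2 3 {2}"
  define T4 where "T4 = add_joined_vertex T3 4 {3}"
  define T where "T = add_joined_vertex T4 5 {3}"
  define T' where "T' = add_joined_vertex T 6 {1}"
  note defs = T_def T4_def T3_def T2_def T1_def T0_def
  have step: "undirected_tree (with_proj (add_joined_vertex H v {u}))"
    if "undirected_tree (with_proj H)" "v \<notin> pverts H" "u \<in> pverts H" for H and v u :: nat
    using tree_extension_add_leaf[OF that] by (simp add: tree_extension_def)
  have T: "undirected_tree (with_proj T)"
    unfolding defs by (intro step undirected_tree_singleton) auto
  have ext: "tree_extension T 6 T'"
    unfolding T'_def using T by (rule tree_extension_add_leaf) (auto simp: defs)
  \<comment> \<open>In \<open>T\<close> the path \<open>0 1 2 3\<close> has degrees \<open>1 2 2 3\<close>; in \<open>T'\<close> every vertex is a strict local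
    extremum of the degree.\<close>
  define es :: "(nat \<times> nat) list" where
    "es = [(0,1),(1,0),(1,2),(2,1),(2,3),(3,2),(3,4),(4,3),(3,5),(5,3)]"
  define es' where "es' = es @ [(6,1),(1,6)]"
  have es: "parcs T = set es" "distinct es" "parcs T' = set es'" "distinct es'"
    by (auto simp: defs T'_def es_def es'_def)
  note deg = out_degree_eq_length_filter[OF es(1,2)]
  have deg': "map (out_degree (with_proj T')) [0, 1, 2, 3, 4, 5, 6] = [1, 3, 2, 3, 1, 1, 1]"
    by (simp add: out_degree_eq_length_filter[OF es(3,4)] es'_def es_def)
  \<comment> \<open>A finite check over consecutive arcs \<open>e\<close> and \<open>f\<close>; the
    condition \<open>fst e \<noteq> snd f\<close> excludes turning back.\<close>
  have no_monotone: "\<forall>e \<in> set es'. \<forall>f \<in> set es'. snd e = fst f \<and> fst e \<noteq> snd f \<longrightarrow>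
    \<not> (out_degree (with_proj T') (fst e) \<le> out_degree (with_proj T') (snd e) \<and>
       out_degree (with_proj T') (fst f) \<le> out_degree (with_proj T') (snd f))"
    using deg' by (simp add: es'_def es_def)
  have "length [0, 1, 2, 3 :: nat] \<le> mp (with_proj T)"
  proof (rule length_le_mp_ascending)
    show "vpath [0, 1, 2, 3] (with_proj T)"
      by (auto simp: vpath_def vwalk_def defs)
  qed (use T in \<open>auto simp: undirected_tree_def deg es_def\<close>)
  moreover have "mp (with_proj T') \<le> 2"
  proof (rule mp_le_ascending)
    fix p assume p: "vpath p (with_proj T')" "sorted (map (out_degree (with_proj T')) p)"
    show "length p \<le> 2"
    proof (rule ccontr)
      assume "\<not> length p \<le> 2"
      then have "Suc (Suc (Suc 0)) \<le> length p" by simp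
      then obtain x y z q where "p = x # y # z # q" by (auto simp: Suc_le_length_iff)
      then have "(x, y) \<in> set es'" "(y, z) \<in> set es'" "x \<noteq> z"
        using p(1) unfolding vpath_def vwalk_def with_proj_simps es(3) by simp_all
      moreover have "out_degree (with_proj T') x \<le> out_degree (with_proj T') y"
        "out_degree (with_proj T') y \<le> out_degree (with_proj T') z"
        using p(2) \<open>p = x # y # z # q\<close> by simp_all
      ultimately show False using no_monotone[THEN bspec, of "(x, y)", THEN bspec, of "(y, z)"] by simp
    qed
  qed (use ext in \<open>auto simp: tree_extension_def undirected_tree_def T'_def\<close>)
  \<comment> \<open>The general bound closes the chain
    \<open>4 \<le> mp T \<le> 2 * mp T' \<le> 4\<close>.\<close>
  ultimately have "mp (with_proj T) = 2 * mp (with_proj T')"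
    using tree_extension_mp[OF ext] by simp
  then show ?thesis using that ext by blast
qed

theorem theorem3p2:
  shows "(\<forall>(T :: 'a pair_pre_digraph) v T'. tree_extension T v T' \<longrightarrow>
            real (mp (with_proj T)) / 2 \<le> real (mp (with_proj T')) \<and>
            real (mp (with_proj T')) \<le> 2 * real (mp (with_proj T)))
       \<and> (\<forall>(T :: 'a pair_pre_digraph) v. tree_deletion T v \<longrightarrow>
            real (mp (with_proj T)) / 2 \<le> real (mp (pre_digraph.del_vert (with_proj T) v)) \<and>
            real (mp (pre_digraph.del_vert (with_proj T) v)) \<le> 2 * real (mp (with_proj T)))
       \<and> (\<exists>(T :: nat pair_pre_digraph) v T'. tree_extension T v T' \<and>
            real (mp (with_proj T)) / 2 = real (mp (with_proj T')))
       \<and> (\<exists>(T :: nat pair_pre_digraph) v T'. tree_extension T v T' \<and>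
            real (mp (with_proj T')) = 2 * real (mp (with_proj T)))
       \<and> (\<exists>(T :: nat pair_pre_digraph) v. tree_deletion T v \<and>
            real (mp (with_proj T)) / 2 = real (mp (pre_digraph.del_vert (with_proj T) v)))
       \<and> (\<exists>(T :: nat pair_pre_digraph) v. tree_deletion T v \<and>
            real (mp (pre_digraph.del_vert (with_proj T) v)) = 2 * real (mp (with_proj T)))"
proof (intro conjI allI impI)
  fix T :: "'a pair_pre_digraph" and v T'
  assume "tree_extension T v T'"
  from tree_extension_mp[OF this]
  show "real (mp (with_proj T)) / 2 \<le> real (mp (with_proj T'))"
    "real (mp (with_proj T')) \<le> 2 * real (mp (with_proj T))"
    by linarith+
next
  fix T :: "'a pair_pre_digraph" and v
  assume "tree_deletion T v"
  then obtain T0 where "tree_extension T0 v T"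
    and del: "pre_digraph.del_vert (with_proj T) v = with_proj T0"
    by (rule tree_deletion_imp_tree_extension)
  from tree_extension_mp[OF this(1)]
  show "real (mp (with_proj T)) / 2 \<le> real (mp (pre_digraph.del_vert (with_proj T) v))"
    "real (mp (pre_digraph.del_vert (with_proj T) v)) \<le> 2 * real (mp (with_proj T))"
    unfolding del by linarith+
next
  \<comment> \<open>One example serves twice: halving under extension is doubling under deletion.
    The next example works the other way round.\<close>
  obtain T T' :: "nat pair_pre_digraph" and v
    where ext: "tree_extension T v T'" and mp: "mp (with_proj T) = 2 * mp (with_proj T')"
    by (rule mp_halves)
  show "\<exists>(T :: nat pair_pre_digraph) v T'. tree_extension T v T' \<and>
      real (mp (with_proj T)) / 2 = real (mp (with_proj T'))"
    using ext mp by (intro exI[of _ T] exI[of _ v] exI[of _ T']) simp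
  show "\<exists>(T :: nat pair_pre_digraph) v. tree_deletion T v \<and>
      real (mp (pre_digraph.del_vert (with_proj T) v)) = 2 * real (mp (with_proj T))"
    using tree_extension_imp_tree_deletion[OF ext] mp by (intro exI[of _ T'] exI[of _ v]) simp
next
  obtain T T' :: "nat pair_pre_digraph" and v
    where ext: "tree_extension T v T'" and mp: "mp (with_proj T') = 2 * mp (with_proj T)"
    by (rule mp_doubles)
  show "\<exists>(T :: nat pair_pre_digraph) v T'. tree_extension T v T' \<and>
      real (mp (with_proj T')) = 2 * real (mp (with_proj T))"
    using ext mp by (intro exI[of _ T] exI[of _ v] exI[of _ T']) simp
  show "\<exists>(T :: nat pair_pre_digraph) v. tree_deletion T v \<and>
      real (mp (with_proj T)) / 2 = real (mp (pre_digraph.del_vert (with_proj T) v))"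
    using tree_extension_imp_tree_deletion[OF ext] mp by (intro exI[of _ T'] exI[of _ v]) simp
qed

end
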